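(* Let $\mathbb{F}$ be a field of characteristic zero and let $\mathcal{A}\subseteq M_\Omega(\mathbb{F})$ be a coherent Jordan algebra. Then there exists a rainbow $\mathcal{C}$ of $\Omega^2$ such that $\{\underline{C}:C\in\mathcal{C}\}$ is the (uniquely determined) standard basis of $\mathcal{A}$, and this rainbow satisfies: for all $C,D\in\mathcal{C}$ and all $\alpha,\alpha',\beta,\beta'\in\Omega$ with $\mathcal{C}(\alpha,\beta)=\mathcal{C}(\alpha',\beta')$, $$|C(\alpha)\cap D^\top(\beta)|+|D(\alpha)\cap C^\top(\beta)|=|C(\alpha')\cap D^\top(\beta')|+|D(\alpha')\cap C^\top(\beta')|.\quad( * )$$ Conversely, if $\mathbb{F}$ is any field with $\mathrm{char}(\mathbb{F})\neq2$ and $(\Omega,\mathcal{C})$ is a rainbow satisfying $( * )$, then the linear span $\mathbb{F}\langle\underline{C}:C\in\mathcal{C}\rangle$ is a coherent Jordan algebra.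
   Context: $\Omega$ is a finite set. For $R\subseteq\Omega^2$: $R(\alpha)=\{\beta:(\alpha,\beta)\in R\}$, $R^\top=\{(\beta,\alpha):(\alpha,\beta)\in R\}$, $\underline{R}$ its $\{0,1\}$ adjacency matrix. For a partition $\mathcal{C}$ of $\Omega^2$, $\mathcal{C}(\alpha,\beta)$ is the class containing $(\alpha,\beta)$. A rainbow is a partition $\mathcal{C}$ of $\Omega^2$ such that $1_\Omega=\{(\omega,\omega)\}$ is a union of classes and $C^\top\in\mathcal{C}$ for every $C\in\mathcal{C}$. A coherent Jordan algebra is a subspace of $M_\Omega(\mathbb{F})$ containing the identity $I_\Omega$ and the all-one matrix $J_\Omega$ and closed under transposition, entrywise (Schur–Hadamard) product $\circ$, and the Jordan product $A\star B=\frac12(AB+BA)$. The standard basis of a $\circ$-closed subspace is its unique basis of $\{0,1\}$-matrices with pairwise disjoint supports. *)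

theory Defs
  imports "HOL-Analysis.Cartesian_Space" "HOL-Library.Disjoint_Sets"
begin

text \<open>
  The finite set \<open>\<Omega>\<close> is the universe of a finite type \<open>'n\<close>, and \<open>M\<^sub>\<Omega>(\<FF>)\<close> is the type \<open>'f^'n^'n\<close>
  over a field \<open>'f\<close>.
\<close>

text \<open>
  The library's \<open>(*s)\<close> scales vectors only, and its global \<open>subspace\<close>, \<open>span\<close> and \<open>independent\<close>
  refer to real scalars; hence a scalar multiplication of matrices by elements of \<open>\<FF>\<close>.
\<close>

definition mat_scale :: "'f::field \<Rightarrow> 'f^'n^'m \<Rightarrow> 'f^'n^'m" where
  "mat_scale c A = (\<chi> i j. c * A $ i $ j)"

global_interpretation mat_space: vector_space "mat_scale :: 'f::field \<Rightarrow> 'f^'n^'m \<Rightarrow> 'f^'n^'m"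
  by standard (simp_all add: mat_scale_def vec_eq_iff algebra_simps)

definition adj_matrix :: "('n \<times> 'n) set \<Rightarrow> 'f::field^'n^'n" where
  "adj_matrix R = (\<chi> i j. if (i, j) \<in> R then 1 else 0)"

definition all_one :: "'f::field^'n^'n" where
  "all_one = (\<chi> i j. 1)"

definition hadamard :: "'f::field^'n^'n \<Rightarrow> 'f^'n^'n \<Rightarrow> 'f^'n^'n" where
  "hadamard A B = (\<chi> i j. A $ i $ j * B $ i $ j)"

text \<open>Meaningful only if the characteristic of the field is not 2, since otherwise \<open>1 / 2 = 0\<close>.\<close>

definition jordan_product :: "'f::field^'n::finite^'n \<Rightarrow> 'f^'n^'n \<Rightarrow> 'f^'n^'n" where
  "jordan_product A B = mat_scale (1 / 2) (A ** B + B ** A)"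

definition coherent_jordan_algebra :: "('f::field^'n::finite^'n) set \<Rightarrow> bool" where
  "coherent_jordan_algebra \<A> \<longleftrightarrow>
     mat_space.subspace \<A> \<and> mat 1 \<in> \<A> \<and> all_one \<in> \<A> \<and>
     (\<forall>A\<in>\<A>. transpose A \<in> \<A>) \<and>
     (\<forall>A\<in>\<A>. \<forall>B\<in>\<A>. hadamard A B \<in> \<A>) \<and>
     (\<forall>A\<in>\<A>. \<forall>B\<in>\<A>. jordan_product A B \<in> \<A>)"

definition mat_support :: "'f::field^'n^'n \<Rightarrow> ('n \<times> 'n) set" where
  "mat_support A = {(i, j). A $ i $ j \<noteq> 0}"

definition is_standard_basis :: "('f::field^'n::finite^'n) set \<Rightarrow> ('f^'n^'n) set \<Rightarrow> bool" where
  "is_standard_basis \<A> \<B> \<longleftrightarrow>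
     mat_space.independent \<B> \<and> mat_space.span \<B> = \<A> \<and>
     (\<forall>B\<in>\<B>. \<forall>i j. B $ i $ j \<in> {0, 1}) \<and>
     (\<forall>B\<in>\<B>. \<forall>B'\<in>\<B>. B \<noteq> B' \<longrightarrow> mat_support B \<inter> mat_support B' = {})"

definition rainbow :: "('n \<times> 'n) set set \<Rightarrow> bool" where
  "rainbow \<C> \<longleftrightarrow>
     partition_on UNIV \<C> \<and> (\<exists>\<S>\<subseteq>\<C>. Id = \<Union>\<S>) \<and> (\<forall>C\<in>\<C>. C\<inverse> \<in> \<C>)"

definition class_of :: "('n \<times> 'n) set set \<Rightarrow> 'n \<Rightarrow> 'n \<Rightarrow> ('n \<times> 'n) set" where
  "class_of \<C> \<alpha> \<beta> = (THE C. C \<in> \<C> \<and> (\<alpha>, \<beta>) \<in> C)"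

text \<open>Below, \<open>C `` {\<alpha>}\<close> is \<open>C(\<alpha>)\<close> and \<open>D\<inverse> `` {\<beta>}\<close> is \<open>D\<^sup>\<top>(\<beta>)\<close>.\<close>

definition jordan_regular :: "('n \<times> 'n) set set \<Rightarrow> bool" where
  "jordan_regular \<C> \<longleftrightarrow>
     (\<forall>C\<in>\<C>. \<forall>D\<in>\<C>. \<forall>\<alpha> \<alpha>' \<beta> \<beta>'. class_of \<C> \<alpha> \<beta> = class_of \<C> \<alpha>' \<beta>' \<longrightarrow>
        card (C `` {\<alpha>} \<inter> D\<inverse> `` {\<beta>}) + card (D `` {\<alpha>} \<inter> C\<inverse> `` {\<beta>}) =
        card (C `` {\<alpha>'} \<inter> D\<inverse> `` {\<beta>'}) + card (D `` {\<alpha>'} \<inter> C\<inverse> `` {\<beta>'}))"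

end

theory Submission
  imports Defs
begin

text \<open>
  A \<open>\<circ>\<close>-closed space containing \<open>J\<close> consists of exactly the matrices that are constant on the
  classes of the relation ``no matrix of the space separates the two positions'': the indicator of
  the class of a position \<open>p\<close> is the Hadamard product, over all positions \<open>q\<close> outside the class, of
  matrices in the space taking the value 1 at \<open>p\<close> and 0 at \<open>q\<close>. Everything else is read off this
  description, since the \<open>(\<alpha>, \<beta>)\<close> entry of \<open>2 (C \<star> D)\<close> is the sum of cardinalities in \<open>(*)\<close>.
\<close>

section \<open>Entries of the basic matrices and of their products\<close>

lemma mat_scale_nth [simp]: "mat_scale c A $ i $ j = c * A $ i $ j"
  by (simp add: mat_scale_def)

lemma adj_matrix_nth [simp]: "adj_matrix R $ i $ j = (if (i, j) \<in> R then 1 else 0)"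
  by (simp add: adj_matrix_def)

lemma all_one_nth [simp]: "all_one $ i $ j = 1"
  by (simp add: all_one_def)

lemma hadamard_nth [simp]: "hadamard A B $ i $ j = A $ i $ j * B $ i $ j"
  by (simp add: hadamard_def)

lemma mat_support_adj_matrix [simp]: "mat_support (adj_matrix R :: 'f::field^'n^'n) = R"
  by (auto simp: mat_support_def)

lemma adj_matrix_mat_support:
  assumes "\<forall>i j. B $ i $ j \<in> {0, 1}"
  shows "adj_matrix (mat_support B) = B"
  using assms by (auto simp: vec_eq_iff mat_support_def)

text \<open>The summand at \<open>k\<close> is 1 exactly when \<open>i\<close>, \<open>k\<close>,
  \<open>j\<close> is a path with first step in \<open>C\<close> and second in \<open>D\<close>, and
  0 otherwise, so the sum counts such midpoints.\<close>

lemma adj_matrix_mult_nth: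
  "(adj_matrix C ** adj_matrix D :: 'f::field^'n::finite^'n) $ i $ j =
     of_nat (card (C `` {i} \<inter> D\<inverse> `` {j}))"
proof -
  have "(adj_matrix C ** adj_matrix D :: 'f^'n^'n) $ i $ j =
          (\<Sum>k\<in>UNIV. if k \<in> C `` {i} \<inter> D\<inverse> `` {j} then 1 else 0)"
    unfolding matrix_matrix_mult_def by (auto intro!: sum.cong)
  also have "\<dots> = of_nat (card (C `` {i} \<inter> D\<inverse> `` {j}))"
    by (subst sum.inter_restrict[symmetric]) simp_all
  finally show ?thesis .
qed

lemma jordan_product_adj_matrix_nth:
  "(jordan_product (adj_matrix C) (adj_matrix D) :: 'f::field^'n::finite^'n) $ i $ j =
     1 / 2 * of_nat (card (C `` {i} \<inter> D\<inverse> `` {j}) + card (D `` {i} \<inter> C\<inverse> `` {j}))"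
  by (simp add: jordan_product_def adj_matrix_mult_nth)

section \<open>Bilinearity of the Jordan product and closure of spans under it\<close>

lemma jordan_product_commute: "jordan_product A B = jordan_product B A"
  by (simp add: jordan_product_def add.commute)

lemma jordan_product_add_left:
  "jordan_product (A + A') B = jordan_product A B + jordan_product A' B"
  by (simp add: jordan_product_def vec_eq_iff matrix_matrix_mult_def sum.distrib algebra_simps)

lemma jordan_product_scale_left:
  "jordan_product (mat_scale c A) B = mat_scale c (jordan_product A B)"
  by (simp add: jordan_product_def vec_eq_iff matrix_matrix_mult_def sum_distrib_left algebra_simps)

lemma jordan_product_zero_left: "jordan_product 0 B = 0"
  by (simp add: jordan_product_def vec_eq_iff matrix_matrix_mult_def)

text \<open>By linearity in the left factor, the matrices whose Jordan product with \<open>B\<close>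
  lies in \<open>V\<close> form a subspace, so checking generators suffices.\<close>

lemma jordan_product_span_left:
  assumes "A \<in> mat_space.span X" "mat_space.subspace V" "\<And>X'. X' \<in> X \<Longrightarrow> jordan_product X' B \<in> V"
  shows "jordan_product A B \<in> V"
  using assms(1)
proof (induction rule: mat_space.span_induct_alt)
  case base
  show ?case
    using assms(2) by (simp add: jordan_product_zero_left mat_space.subspace_0)
next
  case (step c x y)
  then show ?case
    using assms(2,3)
    by (simp add: jordan_product_add_left jordan_product_scale_left
        mat_space.subspace_add mat_space.subspace_scale)
qed

text \<open>Linearity on the left is applied once per factor; commutativity exchanges the factors in
  between.\<close>

lemma jordan_product_span:
  assumes "A \<in> mat_space.span X" "B \<in> mat_space.span X"
    and "\<And>Y Z. Y \<in> X \<Longrightarrow> Z \<in> X \<Longrightarrow> jordan_product Y Z \<in> mat_space.span X"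
  shows "jordan_product A B \<in> mat_space.span X"
proof (rule jordan_product_span_left[OF assms(1) mat_space.subspace_span])
  fix Y assume "Y \<in> X"
  then have "jordan_product B Y \<in> mat_space.span X"
    using assms(2,3) by (intro jordan_product_span_left[OF assms(2)]) auto
  then show "jordan_product Y B \<in> mat_space.span X"
    by (simp add: jordan_product_commute)
qed

section \<open>The partition of positions induced by a set of matrices\<close>

text \<open>This is the kernel of the map taking a position to its evaluation function on
  \<open>\<A>\<close>. Its classes become the rainbow; as they depend on \<open>\<A>\<close> alone,
  they also settle uniqueness.\<close>

definition entry_kernel :: "('f::field^'n::finite^'n) set \<Rightarrow> (('n \<times> 'n) \<times> ('n \<times> 'n)) set" where
  "entry_kernel \<A> = {((i, j), (k, l)). \<forall>A\<in>\<A>. A $ i $ j = A $ k $ l}"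

lemma equiv_entry_kernel: "equiv UNIV (entry_kernel \<A>)"
  by (rule equivI) (auto simp: entry_kernel_def refl_on_def sym_def trans_def)

lemma partition_on_entry_kernel: "partition_on UNIV (UNIV // entry_kernel \<A>)"
  by (rule partition_on_quotient[OF equiv_entry_kernel])

lemma partition_on_class_eq:
  assumes "partition_on UNIV \<C>" "C \<in> \<C>" "p \<in> C" "D \<in> \<C>" "p \<in> D"
  shows "D = C"
  using assms partition_onD2[OF assms(1)] by (auto simp: disjoint_def)

lemma partition_on_classE:
  assumes "partition_on UNIV \<C>"
  obtains C where "C \<in> \<C>" "p \<in> C"
  using partition_onD1[OF assms] by auto

lemma class_of_eq:
  assumes "partition_on UNIV \<C>" "C \<in> \<C>" "(i, j) \<in> C"
  shows "class_of \<C> i j = C"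
  unfolding class_of_def
proof (rule the_equality)
  show "D = C" if "D \<in> \<C> \<and> (i, j) \<in> D" for D
    using partition_on_class_eq[OF assms] that by blast
qed (use assms in simp)

section \<open>Spans of the indicators of a partition\<close>

text \<open>This is the membership test behind all later closure proofs. Constancy on classes passes
  to linear combinations, and a matrix constant on classes is the sum of the class indicators
  weighted by its values.\<close>

lemma span_adj_matrix_partition:
  fixes A :: "'f::field^'n::finite^'n"
  assumes part: "partition_on UNIV \<C>"
  shows "A \<in> mat_space.span (adj_matrix ` \<C>) \<longleftrightarrow>
    (\<forall>C\<in>\<C>. \<forall>i j k l. (i, j) \<in> C \<longrightarrow> (k, l) \<in> C \<longrightarrow> A $ i $ j = A $ k $ l)"
    (is "_ \<longleftrightarrow> ?const A")
proof
  assume "A \<in> mat_space.span (adj_matrix ` \<C>)"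
  then show "?const A"
  proof (induction rule: mat_space.span_induct_alt)
    case (step c x y)
    then obtain D where D: "D \<in> \<C>" "x = adj_matrix D"
      by auto
    show ?case
    proof (intro ballI allI impI)
      fix C i j k l
      assume C: "C \<in> \<C>" "(i, j) \<in> C" "(k, l) \<in> C"
      then have "(i, j) \<in> D \<longleftrightarrow> (k, l) \<in> D"
        using partition_on_class_eq[OF part C(1)] D(1) by blast
      moreover have "y $ i $ j = y $ k $ l"
        using step.IH C by blast
      ultimately show "(mat_scale c x + y) $ i $ j = (mat_scale c x + y) $ k $ l"
        by (simp add: D(2))
    qed
  qed simp
next
  assume const: "?const A"
  \<comment> \<open>\<open>f C\<close> is the common value of \<open>A\<close> on \<open>C\<close>,
    read off at an arbitrarily chosen position.\<close>
  define f where "f C = (let p = SOME p. p \<in> C in A $ fst p $ snd p)" for C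
  have f: "f C = A $ i $ j" if "C \<in> \<C>" "(i, j) \<in> C" for C i j
  proof -
    have "(SOME p. p \<in> C) \<in> C"
      using that(2) by (rule someI)
    then show ?thesis
      using const that unfolding f_def Let_def by (metis prod.collapse)
  qed
  have "A $ i $ j = (\<Sum>C\<in>\<C>. mat_scale (f C) (adj_matrix C)) $ i $ j" for i j
  proof -
    obtain C where C: "C \<in> \<C>" "(i, j) \<in> C"
      using partition_on_classE[OF part] .
    \<comment> \<open>Only the class containing \<open>(i, j)\<close> contributes to this entry of
      the sum.\<close>
    have "(i, j) \<in> D \<longleftrightarrow> D = C" if "D \<in> \<C>" for D
      using partition_on_class_eq[OF part C that] C(2) by blast
    then have "(\<Sum>D\<in>\<C>. mat_scale (f D) (adj_matrix D)) $ i $ j = (\<Sum>D\<in>\<C>. if D = C then f C else 0)"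
      unfolding sum_component by (intro sum.cong) simp_all
    also have "\<dots> = f C"
      using C(1) by simp
    finally show ?thesis
      unfolding f[OF C] ..
  qed
  then have "A = (\<Sum>C\<in>\<C>. mat_scale (f C) (adj_matrix C))"
    unfolding vec_eq_iff by blast
  then show "A \<in> mat_space.span (adj_matrix ` \<C>)"
    by (metis (no_types, lifting) imageI mat_space.span_sum mat_space.span_scale mat_space.span_base)
qed

text \<open>At a position of the nonempty class \<open>C\<close> the indicators of all other classes
  vanish, hence so does their whole span, whereas the indicator of \<open>C\<close> is 1
  there.\<close>

lemma independent_adj_matrix_partition:
  assumes part: "partition_on UNIV \<C>"
  shows "mat_space.independent (adj_matrix ` \<C> :: ('f::field^'n::finite^'n) set)"
proof
  assume "mat_space.dependent (adj_matrix ` \<C> :: ('f^'n^'n) set)"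
  then obtain C where C: "C \<in> \<C>"
    and "(adj_matrix C :: 'f^'n^'n) \<in> mat_space.span (adj_matrix ` \<C> - {adj_matrix C})"
    unfolding mat_space.dependent_def by blast
  obtain i j where ij: "(i, j) \<in> C"
    using partition_onD3[OF part] C by (metis ex_in_conv surj_pair)
  from \<open>(adj_matrix C :: 'f^'n^'n) \<in> mat_space.span (adj_matrix ` \<C> - {adj_matrix C})\<close>
  have "(adj_matrix C :: 'f^'n^'n) $ i $ j = 0"
  proof (induction rule: mat_space.span_induct_alt)
    case (step c x y)
    then obtain D where D: "D \<in> \<C>" "x = adj_matrix D" "D \<noteq> C"
      by auto
    then have "(i, j) \<notin> D"
      using partition_on_class_eq[OF part C ij] by blast
    then show ?case
      using step.IH D(2) by simp
  qed simp
  then show False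
    using ij by simp
qed

lemma is_standard_basis_adj_matrix_partition:
  assumes part: "partition_on UNIV \<C>"
  shows "is_standard_basis (mat_space.span (adj_matrix ` \<C>))
           (adj_matrix ` \<C> :: ('f::field^'n::finite^'n) set)"
proof -
  have "mat_support B \<inter> mat_support B' = {}"
    if "B \<in> adj_matrix ` \<C>" "B' \<in> adj_matrix ` \<C>" "B \<noteq> B'" for B B' :: "'f^'n^'n"
    using that partition_onD2[OF part] by (fastforce simp: disjoint_def)
  then show ?thesis
    unfolding is_standard_basis_def
    using independent_adj_matrix_partition[OF part] by auto
qed

section \<open>Uniqueness of the standard basis\<close>

text \<open>A partition can be recovered from its span: the indicator of \<open>C\<close> separates
  \<open>C\<close> from its complement, while no matrix of the span separates two positions of
  \<open>C\<close>.\<close>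

lemma partition_eq_quotient_entry_kernel:
  fixes \<C> :: "('n::finite \<times> 'n) set set"
  assumes part: "partition_on UNIV \<C>"
  shows "\<C> = UNIV // entry_kernel (mat_space.span (adj_matrix ` \<C>) :: ('f::field^'n^'n) set)"
proof -
  let ?r = "entry_kernel (mat_space.span (adj_matrix ` \<C>) :: ('f^'n^'n) set)"
  have class_eq: "?r `` {p} = C" if C: "C \<in> \<C>" "p \<in> C" for p C
  proof (rule set_eqI)
    fix q :: "'n \<times> 'n"
    obtain i j k l where pq: "p = (i, j)" "q = (k, l)"
      by (metis surj_pair)
    have adj: "(adj_matrix C :: 'f^'n^'n) \<in> mat_space.span (adj_matrix ` \<C>)"
      using C(1) by (intro mat_space.span_base) simp
    have "q \<in> C" if "(p, q) \<in> ?r"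
    proof -
      have "(adj_matrix C :: 'f^'n^'n) $ i $ j = adj_matrix C $ k $ l"
        using that adj unfolding pq entry_kernel_def by blast
      then show ?thesis
        using C(2) pq by (simp split: if_splits)
    qed
    moreover have "(p, q) \<in> ?r" if "q \<in> C"
      using that C span_adj_matrix_partition[OF part] unfolding pq entry_kernel_def by blast
    ultimately show "q \<in> ?r `` {p} \<longleftrightarrow> q \<in> C"
      by blast
  qed
  show ?thesis
  proof (intro equalityI subsetI)
    fix C assume "C \<in> \<C>"
    moreover from this obtain p where "p \<in> C"
      using partition_onD3[OF part] by (metis ex_in_conv)
    ultimately show "C \<in> UNIV // ?r"
      using class_eq by (metis UNIV_I quotientI)
  next
    fix C assume "C \<in> UNIV // ?r"
    then obtain p where "C = ?r `` {p}"
      by (rule quotientE)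
    then show "C \<in> \<C>"
      using class_eq partition_on_classE[OF part] by metis
  qed
qed

text \<open>The supports of a standard basis form a partition: they cover everything because
  \<open>all_one\<close> is in the span, and none is empty because an independent set omits the zero
  matrix. The span \<open>\<A>\<close> then determines this partition.\<close>

lemma standard_basis_unique:
  fixes \<A> :: "('f::field^'n::finite^'n) set"
  assumes basis: "is_standard_basis \<A> \<B>" and J: "all_one \<in> \<A>"
  shows "\<B> = adj_matrix ` (UNIV // entry_kernel \<A>)"
proof -
  define \<D> where "\<D> = mat_support ` \<B>"
  have "adj_matrix (mat_support B) = B" if "B \<in> \<B>" for B
    using basis that by (intro adj_matrix_mat_support) (auto simp: is_standard_basis_def)
  then have \<B>: "\<B> = adj_matrix ` \<D>"
    unfolding \<D>_def by force
  have "\<Union>\<D> = UNIV"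
  proof (rule ccontr)
    assume "\<Union>\<D> \<noteq> UNIV"
    then obtain i j where ij: "\<forall>B\<in>\<B>. B $ i $ j = 0"
      unfolding \<D>_def mat_support_def by auto
    have "(all_one :: 'f^'n^'n) \<in> mat_space.span \<B>"
      using basis J by (simp add: is_standard_basis_def)
    then have "(all_one :: 'f^'n^'n) $ i $ j = 0"
      by (induction rule: mat_space.span_induct_alt) (simp_all add: ij)
    then show False
      by simp
  qed
  moreover have "disjoint \<D>"
    using basis unfolding is_standard_basis_def \<D>_def disjoint_def by (simp, metis)
  moreover have "{} \<notin> \<D>"
  proof
    assume "{} \<in> \<D>"
    then have "(adj_matrix {} :: 'f^'n^'n) \<in> \<B>"
      unfolding \<B> by (rule imageI)
    moreover have "(adj_matrix {} :: 'f^'n^'n) = 0"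
      by (simp add: vec_eq_iff)
    ultimately show False
      using basis mat_space.dependent_zero by (auto simp: is_standard_basis_def)
  qed
  ultimately have part: "partition_on UNIV \<D>"
    by (simp add: partition_on_def)
  have "mat_space.span (adj_matrix ` \<D>) = \<A>"
    using basis \<B> by (simp add: is_standard_basis_def)
  then show ?thesis
    using partition_eq_quotient_entry_kernel[OF part, where 'f = 'f] \<B> by simp
qed

section \<open>From a Hadamard-closed space to a rainbow\<close>

lemma adj_matrix_class_mem:
  fixes \<A> :: "('f::field^'n::finite^'n) set"
  assumes sub: "mat_space.subspace \<A>" and J: "all_one \<in> \<A>"
    and had: "\<And>A B. A \<in> \<A> \<Longrightarrow> B \<in> \<A> \<Longrightarrow> hadamard A B \<in> \<A>"
    and C: "C \<in> UNIV // entry_kernel \<A>"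
  shows "adj_matrix C \<in> \<A>"
proof -
  obtain i j where C_eq: "C = entry_kernel \<A> `` {(i, j)}"
    using C by (metis quotientE surj_pair)
  have sep: "\<exists>B\<in>\<A>. B $ i $ j = 1 \<and> B $ k $ l = 0" if kl: "(k, l) \<notin> C" for k l
  proof -
    obtain A where A: "A \<in> \<A>" "A $ i $ j \<noteq> A $ k $ l"
      using kl unfolding C_eq entry_kernel_def by auto
    \<comment> \<open>An affine normalization of the separating matrix \<open>A\<close>: subtracting
      a multiple of \<open>all_one\<close> makes the entry at \<open>(k, l)\<close> zero, and
      dividing by the nonzero difference makes the entry at \<open>(i, j)\<close> one.\<close>
    define B where "B = mat_scale (1 / (A $ i $ j - A $ k $ l)) (A - mat_scale (A $ k $ l) all_one)"
    have "B \<in> \<A>"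
      unfolding B_def using A(1) J sub
      by (intro mat_space.subspace_scale mat_space.subspace_diff) auto
    moreover have "B $ i $ j = 1" "B $ k $ l = 0"
      using A(2) by (simp_all add: B_def)
    ultimately show ?thesis
      by blast
  qed
  \<comment> \<open>Induction on the set of positions to be annihilated, starting from
    \<open>all_one\<close>, the unit of the Hadamard product, and multiplying in one separating
    matrix for each new position.\<close>
  have "\<exists>B\<in>\<A>. B $ i $ j = 1 \<and> (\<forall>(k, l)\<in>S. B $ k $ l = 0)" if "finite S" "S \<subseteq> - C" for S
    using that
  proof (induction S rule: finite_induct)
    case empty
    show ?case
      using J by (intro bexI[of _ all_one]) auto
  next
    case (insert q S)
    obtain k l where q: "q = (k, l)"
      by (metis surj_pair)
    obtain B where B: "B \<in> \<A>" "B $ i $ j = 1" "\<forall>(k, l)\<in>S. B $ k $ l = 0"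
      using insert by auto
    obtain B' where B': "B' \<in> \<A>" "B' $ i $ j = 1" "B' $ k $ l = 0"
      using sep[of k l] insert.prems q by auto
    show ?case
      using B B' had[of B B'] q by (intro bexI[of _ "hadamard B B'"]) auto
  qed
  from this[of "- C"] obtain B where B: "B \<in> \<A>" "B $ i $ j = 1" "\<forall>(k, l)\<in>- C. B $ k $ l = 0"
    by auto
  \<comment> \<open>The value 1 spreads from \<open>(i, j)\<close> over all of \<open>C\<close>,
    since \<open>B\<close> is in \<open>\<A>\<close> and so cannot separate positions of one
    class.\<close>
  have "B $ k $ l = 1" if "(k, l) \<in> C" for k l
    using that B(1,2) unfolding C_eq entry_kernel_def by auto
  then have "B = adj_matrix C"
    using B(3) by (fastforce simp: vec_eq_iff)
  then show ?thesis
    using B(1) by simp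
qed

lemma span_adj_matrix_quotient:
  fixes \<A> :: "('f::field^'n::finite^'n) set"
  assumes "mat_space.subspace \<A>" "all_one \<in> \<A>"
    and "\<And>A B. A \<in> \<A> \<Longrightarrow> B \<in> \<A> \<Longrightarrow> hadamard A B \<in> \<A>"
  shows "mat_space.span (adj_matrix ` (UNIV // entry_kernel \<A>)) = \<A>"
proof
  show "mat_space.span (adj_matrix ` (UNIV // entry_kernel \<A>)) \<subseteq> \<A>"
    using adj_matrix_class_mem[OF assms] assms(1) by (intro mat_space.span_minimal) auto
  show "\<A> \<subseteq> mat_space.span (adj_matrix ` (UNIV // entry_kernel \<A>))"
    unfolding subset_iff span_adj_matrix_partition[OF partition_on_entry_kernel]
    by (auto simp: quotient_def entry_kernel_def)
qed

text \<open>The identity matrix separates diagonal from off-diagonal positions, and closure under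
  transposition makes the kernel invariant under swapping coordinates.\<close>

lemma rainbow_quotient_entry_kernel:
  fixes \<A> :: "('f::field^'n::finite^'n) set"
  assumes one: "mat 1 \<in> \<A>" and trans: "\<And>A. A \<in> \<A> \<Longrightarrow> transpose A \<in> \<A>"
  shows "rainbow (UNIV // entry_kernel \<A>)"
proof -
  let ?r = "entry_kernel \<A>"
  have diag: "k = l" if "((i, i), (k, l)) \<in> ?r" for i k l
  proof -
    have "(mat 1 :: 'f^'n^'n) $ i $ i = mat 1 $ k $ l"
      using that one unfolding entry_kernel_def by blast
    then show ?thesis
      by (simp add: mat_def split: if_splits)
  qed
  have "Id = \<Union>((\<lambda>i. ?r `` {(i, i)}) ` UNIV)"
    using diag by (auto simp: entry_kernel_def)
  moreover have "(\<lambda>i. ?r `` {(i, i)}) ` UNIV \<subseteq> UNIV // ?r"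
    by (auto intro: quotientI)
  ultimately have "\<exists>\<S>\<subseteq>UNIV // ?r. Id = \<Union>\<S>"
    by blast
  moreover have "C\<inverse> \<in> UNIV // ?r" if "C \<in> UNIV // ?r" for C
  proof -
    obtain i j where C: "C = ?r `` {(i, j)}"
      using \<open>C \<in> UNIV // ?r\<close> by (metis quotientE surj_pair)
    have swap: "((j, i), (l, k)) \<in> ?r" if "((i, j), (k, l)) \<in> ?r" for i j k l
      unfolding entry_kernel_def
    proof (clarify)
      fix A assume "A \<in> \<A>"
      then have "transpose A $ i $ j = transpose A $ k $ l"
        using trans that unfolding entry_kernel_def by blast
      then show "A $ j $ i = A $ l $ k"
        by (simp add: transpose_def)
    qed
    \<comment> \<open>Both inclusions come from \<open>swap\<close>, used in the two
      directions.\<close>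
    have "C\<inverse> = ?r `` {(j, i)}"
      unfolding C by (auto dest: swap)
    then show ?thesis
      by (auto intro: quotientI)
  qed
  ultimately show ?thesis
    unfolding rainbow_def using partition_on_entry_kernel by blast
qed

section \<open>Jordan closure and the counting condition\<close>

text \<open>The equation stays in the field, factor 1/2 included, to serve both directions: in
  characteristic zero it cancels down to natural numbers, and an equality of natural numbers always
  implies it.\<close>

lemma jordan_product_mem_span_iff:
  fixes \<C> :: "('n::finite \<times> 'n) set set"
  assumes part: "partition_on UNIV \<C>"
  shows "(jordan_product (adj_matrix C) (adj_matrix D) :: 'f::field^'n^'n)
            \<in> mat_space.span (adj_matrix ` \<C>) \<longleftrightarrow>
    (\<forall>\<alpha> \<alpha>' \<beta> \<beta>'. class_of \<C> \<alpha> \<beta> = class_of \<C> \<alpha>' \<beta>' \<longrightarrow>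
      1 / 2 * (of_nat (card (C `` {\<alpha>} \<inter> D\<inverse> `` {\<beta>}) + card (D `` {\<alpha>} \<inter> C\<inverse> `` {\<beta>})) :: 'f) =
      1 / 2 * of_nat (card (C `` {\<alpha>'} \<inter> D\<inverse> `` {\<beta>'}) + card (D `` {\<alpha>'} \<inter> C\<inverse> `` {\<beta>'})))"
proof -
  have "class_of \<C> \<alpha> \<beta> = class_of \<C> \<alpha>' \<beta>' \<longleftrightarrow> (\<exists>E\<in>\<C>. (\<alpha>, \<beta>) \<in> E \<and> (\<alpha>', \<beta>') \<in> E)"
    for \<alpha> \<beta> \<alpha>' \<beta>'
    using class_of_eq[OF part] partition_on_classE[OF part] by metis
  then have "(\<forall>C\<in>\<C>. \<forall>i j k l. (i, j) \<in> C \<longrightarrow> (k, l) \<in> C \<longrightarrow> F i j = F k l) \<longleftrightarrow>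
      (\<forall>\<alpha> \<alpha>' \<beta> \<beta>'. class_of \<C> \<alpha> \<beta> = class_of \<C> \<alpha>' \<beta>' \<longrightarrow> F \<alpha> \<beta> = F \<alpha>' \<beta>')"
    for F :: "'n \<Rightarrow> 'n \<Rightarrow> 'f"
    by (simp only:) blast
  then show ?thesis
    unfolding span_adj_matrix_partition[OF part] jordan_product_adj_matrix_nth .
qed

lemma jordan_regularI_span:
  fixes \<C> :: "('n::finite \<times> 'n) set set"
  assumes char: "CHAR('f::field) = 0" and part: "partition_on UNIV \<C>"
    and closed: "\<And>C D. C \<in> \<C> \<Longrightarrow> D \<in> \<C> \<Longrightarrow>
      (jordan_product (adj_matrix C) (adj_matrix D) :: 'f^'n^'n) \<in> mat_space.span (adj_matrix ` \<C>)"
  shows "jordan_regular \<C>"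
proof -
  \<comment> \<open>With \<open>m \<le> n\<close> the natural subtraction is not truncated; the
    difference maps to 0, so it is divisible by the characteristic 0 and must be 0.\<close>
  have inj_le: "m = n" if "of_nat m = (of_nat n :: 'f)" "m \<le> n" for m n
  proof -
    have "of_nat (n - m) = (0 :: 'f)"
      using that by (simp add: of_nat_diff)
    then show ?thesis
      unfolding of_nat_eq_0_iff_char_dvd char using \<open>m \<le> n\<close> by simp
  qed
  have inj: "of_nat m = (of_nat n :: 'f) \<longleftrightarrow> m = n" for m n
    using inj_le[of m n] inj_le[of n m] by (metis nat_le_linear)
  have "(2 :: 'f) \<noteq> 0"
    using inj[of 2 0] by simp
  then have "1 / 2 * of_nat m = 1 / 2 * (of_nat n :: 'f) \<longleftrightarrow> m = n" for m n
    using inj[of m n] by simp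
  then show ?thesis
    using closed unfolding jordan_regular_def jordan_product_mem_span_iff[OF part] by blast
qed

text \<open>Apart from the Jordan product, each closure property is checked as constancy on classes;
  the Jordan product is first reduced by bilinearity to pairs of indicators.\<close>

lemma coherent_jordan_algebra_span:
  fixes \<C> :: "('n::finite \<times> 'n) set set"
  assumes rainbow: "rainbow \<C>" and regular: "jordan_regular \<C>"
  shows "coherent_jordan_algebra (mat_space.span (adj_matrix ` \<C>) :: ('f::field^'n^'n) set)"
proof -
  have part: "partition_on UNIV \<C>" and conv: "\<And>C. C \<in> \<C> \<Longrightarrow> C\<inverse> \<in> \<C>"
    using rainbow by (auto simp: rainbow_def)
  obtain \<S> where \<S>: "\<S> \<subseteq> \<C>" "Id = \<Union>\<S>"
    using rainbow by (auto simp: rainbow_def)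
  note mem = span_adj_matrix_partition[OF part]
  have diag: "i = j \<longleftrightarrow> k = l" if "C \<in> \<C>" "(i, j) \<in> C" "(k, l) \<in> C" for C i j k l
  proof -
    \<comment> \<open>A class meeting the diagonal is one of the classes in \<open>\<S>\<close> and
      thus lies inside it, so all positions of \<open>C\<close> agree on being diagonal.\<close>
    have "p \<in> Id \<longleftrightarrow> C \<in> \<S>" if "p \<in> C" for p
      using partition_on_class_eq[OF part \<open>C \<in> \<C>\<close> that] \<S> that by blast
    then show ?thesis
      using that by (metis pair_in_Id_conv)
  qed
  have "mat 1 \<in> (mat_space.span (adj_matrix ` \<C>) :: ('f^'n^'n) set)"
    unfolding mem
  proof (intro ballI allI impI)
    fix C i j k l assume "C \<in> \<C>" "(i, j) \<in> C" "(k, l) \<in> C"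
    then show "(mat 1 :: 'f^'n^'n) $ i $ j = mat 1 $ k $ l"
      using diag[of C i j k l] by (simp add: mat_def)
  qed
  moreover have "all_one \<in> (mat_space.span (adj_matrix ` \<C>) :: ('f^'n^'n) set)"
    unfolding mem by simp
  moreover have "transpose A \<in> mat_space.span (adj_matrix ` \<C>)"
    if "A \<in> mat_space.span (adj_matrix ` \<C>)" for A :: "'f^'n^'n"
    unfolding mem
  proof (intro ballI allI impI)
    fix C i j k l assume "C \<in> \<C>" "(i, j) \<in> C" "(k, l) \<in> C"
    then have "C\<inverse> \<in> \<C>" "(j, i) \<in> C\<inverse>" "(l, k) \<in> C\<inverse>"
      using conv by auto
    then have "A $ j $ i = A $ l $ k"
      using that unfolding mem by blast
    then show "transpose A $ i $ j = transpose A $ k $ l"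
      by (simp add: transpose_def)
  qed
  moreover have "hadamard A B \<in> mat_space.span (adj_matrix ` \<C>)"
    if "A \<in> mat_space.span (adj_matrix ` \<C>)" "B \<in> mat_space.span (adj_matrix ` \<C>)"
    for A B :: "'f^'n^'n"
    unfolding mem
  proof (intro ballI allI impI)
    fix C i j k l assume C: "C \<in> \<C>" "(i, j) \<in> C" "(k, l) \<in> C"
    show "hadamard A B $ i $ j = hadamard A B $ k $ l"
      by (simp add: that(1)[unfolded mem, rule_format, OF C] that(2)[unfolded mem, rule_format, OF C])
  qed
  moreover have "jordan_product A B \<in> mat_space.span (adj_matrix ` \<C>)"
    if "A \<in> mat_space.span (adj_matrix ` \<C>)" "B \<in> mat_space.span (adj_matrix ` \<C>)"
    for A B :: "'f^'n^'n"
  proof (rule jordan_product_span[OF that])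
    fix Y Z :: "'f^'n^'n"
    assume "Y \<in> adj_matrix ` \<C>" "Z \<in> adj_matrix ` \<C>"
    then obtain C D where CD: "C \<in> \<C>" "D \<in> \<C>" "Y = adj_matrix C" "Z = adj_matrix D"
      by blast
    show "jordan_product Y Z \<in> mat_space.span (adj_matrix ` \<C>)"
      unfolding CD(3,4) jordan_product_mem_span_iff[OF part]
    proof (intro allI impI)
      fix \<alpha> \<alpha>' \<beta> \<beta>'
      assume "class_of \<C> \<alpha> \<beta> = class_of \<C> \<alpha>' \<beta>'"
      from regular[unfolded jordan_regular_def, rule_format, OF CD(1,2) this]
      show "1 / 2 * (of_nat (card (C `` {\<alpha>} \<inter> D\<inverse> `` {\<beta>}) + card (D `` {\<alpha>} \<inter> C\<inverse> `` {\<beta>})) :: 'f) =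
        1 / 2 * of_nat (card (C `` {\<alpha>'} \<inter> D\<inverse> `` {\<beta>'}) + card (D `` {\<alpha>'} \<inter> C\<inverse> `` {\<beta>'}))"
        by (simp only:)
    qed
  qed
  ultimately show ?thesis
    unfolding coherent_jordan_algebra_def using mat_space.subspace_span by blast
qed

theorem theorem1p5:
  shows "(CHAR('f::field) = 0 \<longrightarrow>
            (\<forall>\<A> :: ('f^'n::finite^'n) set. coherent_jordan_algebra \<A> \<longrightarrow>
               (\<exists>\<C> :: ('n \<times> 'n) set set.
                  rainbow \<C> \<and>
                  is_standard_basis \<A> (adj_matrix ` \<C>) \<and>
                  (\<forall>\<B>. is_standard_basis \<A> \<B> \<longrightarrow> \<B> = adj_matrix ` \<C>) \<and>
                  jordan_regular \<C>))) \<and>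
         (CHAR('f) \<noteq> 2 \<longrightarrow>
            (\<forall>\<C> :: ('n \<times> 'n) set set. rainbow \<C> \<and> jordan_regular \<C> \<longrightarrow>
               coherent_jordan_algebra
                 (mat_space.span (adj_matrix ` \<C>) :: ('f^'n^'n) set)))"
proof (intro conjI impI allI)
  fix \<A> :: "('f^'n::finite^'n) set"
  assume char: "CHAR('f) = 0" and "coherent_jordan_algebra \<A>"
  then have sub: "mat_space.subspace \<A>" and one: "mat 1 \<in> \<A>" and J: "all_one \<in> \<A>"
    and trans: "\<And>A. A \<in> \<A> \<Longrightarrow> transpose A \<in> \<A>"
    and had: "\<And>A B. A \<in> \<A> \<Longrightarrow> B \<in> \<A> \<Longrightarrow> hadamard A B \<in> \<A>"
    and jordan: "\<And>A B. A \<in> \<A> \<Longrightarrow> B \<in> \<A> \<Longrightarrow> jordan_product A B \<in> \<A>"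
    by (auto simp: coherent_jordan_algebra_def)
  define \<C> where "\<C> = UNIV // entry_kernel \<A>"
  have part: "partition_on UNIV \<C>"
    unfolding \<C>_def by (rule partition_on_entry_kernel)
  have span: "mat_space.span (adj_matrix ` \<C>) = \<A>"
    unfolding \<C>_def using sub J had by (rule span_adj_matrix_quotient)
  have "rainbow \<C>"
    unfolding \<C>_def using one trans by (rule rainbow_quotient_entry_kernel)
  moreover have "is_standard_basis \<A> (adj_matrix ` \<C>)"
    using is_standard_basis_adj_matrix_partition[OF part, where 'f = 'f] span by simp
  moreover have "\<forall>\<B>. is_standard_basis \<A> \<B> \<longrightarrow> \<B> = adj_matrix ` \<C>"
    unfolding \<C>_def using standard_basis_unique J by blast
  moreover have "jordan_regular \<C>"
  \<comment> \<open>The indicators of the classes lie in \<open>\<A>\<close>, which is Jordan-closed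
    and equals their span.\<close>
  proof (rule jordan_regularI_span[OF char part])
    fix C D assume "C \<in> \<C>" "D \<in> \<C>"
    then show "(jordan_product (adj_matrix C) (adj_matrix D) :: 'f^'n^'n)
        \<in> mat_space.span (adj_matrix ` \<C>)"
      unfolding span using jordan adj_matrix_class_mem[OF sub J had] by (simp add: \<C>_def)
  qed
  ultimately show "\<exists>\<C>. rainbow \<C> \<and> is_standard_basis \<A> (adj_matrix ` \<C>) \<and>
      (\<forall>\<B>. is_standard_basis \<A> \<B> \<longrightarrow> \<B> = adj_matrix ` \<C>) \<and> jordan_regular \<C>"
    by blast
next
  fix \<C> :: "('n \<times> 'n) set set"
  assume "rainbow \<C> \<and> jordan_regular \<C>"
  then show "coherent_jordan_algebra (mat_space.span (adj_matrix ` \<C>) :: ('f^'n^'n) set)"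
    by (simp add: coherent_jordan_algebra_span)
qed

end
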